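(* For every integer $N\ge 1$, the function $F=F(t,x)=\dfrac{1}{\sqrt{1-2tx+t^{2}}}$ satisfies the non-linear differential equation $$(2N-1)!!\,F^{2N+1}=\sum_{i=1}^{N}a_i(N)\,\frac{F^{(i)}}{(x-t)^{2N-i}}$$ for all real $t,x$ with $1-2tx+t^2>0$ and $t\neq x$, where $F^{(i)}=\left(\frac{\partial}{\partial t}\right)^{i}F(t,x)$, $F^{2N+1}$ is the $(2N+1)$-st power of $F$, and the coefficients are given by $a_1(N)=(2N-3)!!$, $a_N(N)=1$, and, for $2\le i\le N-1$, writing $s_0=0$ and $s_j=l_1+\cdots+l_j$, $$a_i(N)=\sum_{k=1}^{i-1}\;\sum_{l_1=0}^{N-s_0-i-1}\;\sum_{l_2=0}^{N-s_1-i-1}\cdots\sum_{l_{k-1}=0}^{N-s_{k-2}-i-1}\left(\prod_{j=1}^{k-1}\left\langle 2N-2s_{j-1}-i-j-1\right\rangle_{l_j}\right)\prod_{m=0}^{N-s_{k-1}-i-1}\left(2N-2s_{k-1}-2m-i-k-1\right)$$ $$\qquad+\sum_{l_1=0}^{N-s_0-i-1}\;\sum_{l_2=0}^{N-s_1-i-1}\cdots\sum_{l_{i-1}=0}^{N-s_{i-2}-i-1}\left(\prod_{j=1}^{i-1}\left\langle 2N-2s_{j-1}-i-j-1\right\rangle_{l_j}\right)\bigl(2(N-s_{i-1}-i)-1\bigr)!!.$$ (For $k=1$ there are no summation indices and the first product is empty, so that the $k=1$ term is $\prod_{m=0}^{N-i-1}(2N-2m-i-2)$.)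
   Context: Double factorial: $n!!=n(n-2)\cdots 5\cdot3\cdot1$ for odd $n>0$, $n!!=n(n-2)\cdots 6\cdot 4\cdot 2$ for even $n>0$, and $(-1)!!=0!!=1$. For an integer $M$ and an integer $k\ge 0$, $\langle M\rangle_k=M(M-2)(M-4)\cdots(M-2(k-1))$ ($k$ factors decreasing in steps of $2$), with $\langle M\rangle_0=1$. *)

theory Defs
  imports "HOL-Analysis.Analysis"
begin

text \<open>Double factorial on the integers, so that \<open>(-1)!! = 0!! = 1\<close> can be expressed directly.
  Only arguments \<open>n \<ge> -1\<close> are meaningful.\<close>

function dfact :: "int \<Rightarrow> int" where
  "dfact n = (if n \<le> 0 then 1 else n * dfact (n - 2))"
  by auto
termination by (relation "Wellfounded.measure nat") auto

declare dfact.simps [simp del]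

definition fall2 :: "int \<Rightarrow> nat \<Rightarrow> int" where
  "fall2 M k = (\<Prod>r<k. M - 2 * int r)"

text \<open>\<open>nested_sum N i n g ls\<close> sums over \<open>n\<close> further indices when the indices chosen so far are
  \<open>ls = [l\<^sub>1, \<dots>, l\<^sub>j]\<close>. The next index runs over \<open>0 \<le> l \<le> N - s\<^sub>j - i - 1\<close> with
  \<open>s\<^sub>j = sum_list ls\<close>. The range is written half-open: truncated subtraction is then harmless,
  since a negative upper limit gives an empty sum.\<close>

primrec nested_sum :: "nat \<Rightarrow> nat \<Rightarrow> nat \<Rightarrow> (nat list \<Rightarrow> int) \<Rightarrow> nat list \<Rightarrow> int" where
  "nested_sum N i 0 g ls = g ls"
| "nested_sum N i (Suc n) g ls = (\<Sum>l<N - sum_list ls - i. nested_sum N i n g (ls @ [l]))"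

text \<open>The partial sum \<open>s\<^sub>j = l\<^sub>1 + \<dots> + l\<^sub>j\<close>; the list is 0-based, so \<open>l\<^sub>j\<close> is \<open>ls ! (j - 1)\<close>.\<close>

definition psum :: "nat list \<Rightarrow> nat \<Rightarrow> int" where
  "psum ls j = int (sum_list (take j ls))"

definition fall_prod :: "nat \<Rightarrow> nat \<Rightarrow> nat \<Rightarrow> nat list \<Rightarrow> int" where
  "fall_prod N i n ls =
     (\<Prod>j=1..n. fall2 (2 * int N - 2 * psum ls (j - 1) - int i - int j - 1) (ls ! (j - 1)))"

definition a_coeff :: "nat \<Rightarrow> nat \<Rightarrow> int" where
  "a_coeff N i =
     (if i = 1 then dfact (2 * int N - 3)
      else if i = N then 1
      else
        (\<Sum>k=1..i-1. nested_sum N i (k - 1)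
           (\<lambda>ls. fall_prod N i (k - 1) ls *
                 (\<Prod>m<N - sum_list ls - i.
                    2 * int N - 2 * psum ls (k - 1) - 2 * int m - int i - int k - 1)) [])
        + nested_sum N i (i - 1)
           (\<lambda>ls. fall_prod N i (i - 1) ls *
                 dfact (2 * (int N - psum ls (i - 1) - int i) - 1)) [])"

definition F :: "real \<Rightarrow> real \<Rightarrow> real" where
  "F t x = 1 / sqrt (1 - 2 * t * x + t\<^sup>2)"

end

theory Submission
  imports Defs
begin

text \<open>Since \<open>\<partial>F/\<partial>t = (x - t) F\<^sup>3\<close>, differentiating \<open>F\<^sup>2\<^sup>N\<^sup>+\<^sup>1\<close> and dividing by \<open>x - t\<close> gives
  \<open>(2N + 1) F\<^sup>2\<^sup>N\<^sup>+\<^sup>3\<close>. Applied to an expansion of \<open>(2N - 1)!! F\<^sup>2\<^sup>N\<^sup>+\<^sup>1\<close> in the functions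
  \<open>F\<^sup>(\<^sup>i\<^sup>) / (x - t)\<^sup>2\<^sup>N\<^sup>-\<^sup>i\<close>, the same operation sends such a function to
  \<open>F\<^sup>(\<^sup>i\<^sup>+\<^sup>1\<^sup>) / (x - t)\<^sup>2\<^sup>N\<^sup>+\<^sup>1\<^sup>-\<^sup>i + (2N - i) F\<^sup>(\<^sup>i\<^sup>) / (x - t)\<^sup>2\<^sup>N\<^sup>+\<^sup>2\<^sup>-\<^sup>i\<close>. An expansion for \<open>N\<close> therefore yields
  one for \<open>N + 1\<close>, with coefficients given by
  \<open>b (N + 1) i = (2N - i) b N i + b N (i - 1)\<close>. The induction can start at \<open>N = 0\<close>, where the identity
  reads \<open>F = F\<close>; this is \<open>power_F_expansion\<close>.

  It remains to solve the recurrence. Applying it repeatedly to the term with index \<open>i\<close> gives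
  \<open>b N i\<close> as the contribution of \<open>b i i = 1\<close> plus a sum over \<open>l\<close>, the number of
  steps made before the index drops, of multiples of \<open>b (N - l - 1) (i - 1)\<close> (\<open>ode_coeff_unroll\<close>).
  Doing this \<open>i - 1\<close> times produces one more summation index each time
  (\<open>ode_coeff_nested_expansion\<close>): the contributions of the diagonal entries are the terms of the
  sum over \<open>k\<close>, and the second nested sum is what remains at index \<open>1\<close>, where the
  recurrence gives a double factorial.\<close>

section \<open>The recurrence for the coefficients\<close>

text \<open>The row \<open>N = 0\<close> and the column \<open>i = 0\<close> do not occur among the \<open>a\<^sub>i(N)\<close>. Including them makes
  the identity for \<open>N = 0\<close> trivial and leaves one recurrence without boundary cases.\<close>

primrec ode_coeff :: "nat \<Rightarrow> nat \<Rightarrow> int" where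
  "ode_coeff 0 i = (if i = 0 then 1 else 0)"
| "ode_coeff (Suc N) i = (2 * int N - int i) * ode_coeff N i
     + (case i of 0 \<Rightarrow> 0 | Suc j \<Rightarrow> ode_coeff N j)"

lemma dfact_step: "n \<ge> -1 \<Longrightarrow> dfact (n + 2) = (n + 2) * dfact n"
  by (subst dfact.simps) (auto simp: dfact.simps[of n])

lemma ode_coeff_eq_0: "i > N \<Longrightarrow> ode_coeff N i = 0"
  by (induction N arbitrary: i) (auto split: nat.splits)

lemma ode_coeff_diag [simp]: "ode_coeff N N = 1"
  by (induction N) (auto simp: ode_coeff_eq_0)

lemma ode_coeff_0 [simp]: "N \<ge> 1 \<Longrightarrow> ode_coeff N 0 = 0"
proof (induction N)
  case (Suc N)
  then show ?case by (cases N) auto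
qed simp

lemma ode_coeff_1: "ode_coeff (Suc N) 1 = dfact (2 * int N - 1)"
proof (induction N)
  case 0
  then show ?case by (simp add: dfact.simps)
next
  case (Suc N)
  have "ode_coeff (Suc (Suc N)) 1 = (2 * int N + 1) * dfact (2 * int N - 1)"
    using ode_coeff.simps(2)[of "Suc N" 1] Suc ode_coeff_0[of "Suc N"]
    by (simp del: ode_coeff.simps ode_coeff_0)
  also have "\<dots> = dfact (2 * int N - 1 + 2)"
    by (subst dfact_step) (auto simp: algebra_simps)
  finally show ?case by (simp add: algebra_simps)
qed

section \<open>Expansion of odd powers in derivatives\<close>

context
  fixes x :: real
begin

abbreviation Q :: "real \<Rightarrow> real" where "Q s \<equiv> 1 - 2 * s * x + s\<^sup>2"

abbreviation DF :: "nat \<Rightarrow> real \<Rightarrow> real" where "DF i \<equiv> (deriv ^^ i) (\<lambda>s. F s x)"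

lemma open_Q_pos: "open {s. Q s > 0}"
  by (intro open_Collect_less continuous_intros)

lemma F_square: "Q s > 0 \<Longrightarrow> (F s x)\<^sup>2 * Q s = 1"
  by (simp add: F_def power_divide)

lemma F_has_derivative:
  assumes "Q s > 0"
  shows "((\<lambda>s. F s x) has_real_derivative (x - s) * F s x ^ 3) (at s)"
proof -
  have "((\<lambda>s. F s x) has_real_derivative (x - s) / (sqrt (Q s) * (sqrt (Q s))\<^sup>2)) (at s)"
    unfolding F_def using assms
    by (auto intro!: derivative_eq_intros simp: divide_simps power2_eq_square algebra_simps)
  moreover have "(x - s) / (sqrt (Q s) * (sqrt (Q s))\<^sup>2) = (x - s) * F s x ^ 3"
    by (simp add: F_def power3_eq_cube power2_eq_square)
  ultimately show ?thesis by simp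
qed

lemma F_power_has_derivative:
  assumes "Q s > 0"
  shows "((\<lambda>s. F s x ^ (2 * n + 1)) has_real_derivative
           real (2 * n + 1) * (x - s) * F s x ^ (2 * n + 3)) (at s)"
proof -
  have "((\<lambda>s. F s x ^ (2 * n + 1)) has_real_derivative
           real (2 * n + 1) * (((x - s) * F s x ^ 3) * F s x ^ (2 * n))) (at s)"
    using DERIV_power[OF F_has_derivative[OF assms], of "2 * n + 1"] by simp
  then show ?thesis
    by (simp add: power_add mult_ac)
qed

text \<open>This closed form serves to show that \<open>F\<close> is infinitely differentiable where \<open>Q\<close> is positive.
  It is preserved by differentiation because \<open>F\<^sup>2 Q = 1\<close> lets the derivative of the polynomial factor
  be brought to the higher power of \<open>F\<close>.\<close>

lemma higher_deriv_F_closed_form: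
  "\<exists>p. \<forall>s. Q s > 0 \<longrightarrow> DF i s = poly p s * F s x ^ (2 * i + 1)"
proof (induction i)
  case 0
  show ?case by (rule exI[of _ 1]) auto
next
  case (Suc i)
  then obtain p where p: "\<And>s. Q s > 0 \<Longrightarrow> DF i s = poly p s * F s x ^ (2 * i + 1)"
    by blast
  define p' where "p' = pderiv p * [:1, - 2 * x, 1:] + smult (real (2 * i + 1)) (p * [:x, -1:])"
  have "DF (Suc i) s = poly p' s * F s x ^ (2 * Suc i + 1)" if s: "Q s > 0" for s
  proof -
    have "((\<lambda>s. poly p s * F s x ^ (2 * i + 1)) has_real_derivative
        poly p s * (real (2 * i + 1) * (x - s) * F s x ^ (2 * i + 3))
        + poly (pderiv p) s * F s x ^ (2 * i + 1)) (at s)"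
      by (rule DERIV_cong[OF DERIV_mult[OF poly_DERIV F_power_has_derivative[OF s]]])
         (simp add: algebra_simps)
    then have "(DF i has_real_derivative
        poly p s * (real (2 * i + 1) * (x - s) * F s x ^ (2 * i + 3))
        + poly (pderiv p) s * F s x ^ (2 * i + 1)) (at s)"
      by (rule has_field_derivative_transform_within_open[OF _ open_Q_pos])
         (use s p in auto)
    then have "DF (Suc i) s =
        poly p s * (real (2 * i + 1) * (x - s) * F s x ^ (2 * i + 3))
        + poly (pderiv p) s * F s x ^ (2 * i + 1)"
      by (simp add: DERIV_imp_deriv)
    also have "F s x ^ (2 * i + 1) = F s x ^ (2 * i + 3) * Q s"
    proof -
      have "F s x ^ (2 * i + 3) * Q s = F s x ^ (2 * i + 1) * ((F s x)\<^sup>2 * Q s)"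
        by (simp add: power_add power2_eq_square power3_eq_cube)
      then show ?thesis by (simp only: F_square[OF s])
    qed
    also have "poly p s * (real (2 * i + 1) * (x - s) * F s x ^ (2 * i + 3))
        + poly (pderiv p) s * (F s x ^ (2 * i + 3) * Q s) = poly p' s * F s x ^ (2 * i + 3)"
      by (simp add: p'_def algebra_simps power2_eq_square)
    finally show ?thesis by (simp add: numeral_3_eq_3)
  qed
  then show ?case by blast
qed

lemma higher_deriv_F_has_derivative:
  assumes s: "Q s > 0"
  shows "(DF i has_real_derivative DF (Suc i) s) (at s)"
proof -
  obtain p where p: "\<And>s. Q s > 0 \<Longrightarrow> DF i s = poly p s * F s x ^ (2 * i + 1)"
    using higher_deriv_F_closed_form by blast
  obtain d where "(DF i has_real_derivative d) (at s)"
    using has_field_derivative_transform_within_open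
        [OF DERIV_mult[OF poly_DERIV[of p] F_power_has_derivative[OF s, of i]] open_Q_pos, of "DF i"]
      s p by auto
  then show ?thesis
    by (simp add: DERIV_imp_deriv)
qed

lemma higher_deriv_F_quotient_has_derivative:
  assumes "Q s > 0" "s \<noteq> x"
  shows "((\<lambda>s. DF i s / (x - s) ^ e) has_real_derivative
           DF (Suc i) s / (x - s) ^ e + real e * DF i s / (x - s) ^ Suc e) (at s)"
proof (cases e)
  case 0
  then show ?thesis using higher_deriv_F_has_derivative[OF assms(1), of i] by simp
next
  case (Suc d)
  have nz: "x - s \<noteq> 0" using assms by simp
  have den: "((\<lambda>s. (x - s) ^ e) has_real_derivative - real e * (x - s) ^ d) (at s)"
    by (rule DERIV_cong[OF DERIV_power[of _ "-1"]])
       (auto simp: Suc algebra_simps intro!: derivative_eq_intros)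
  have "((\<lambda>s. DF i s / (x - s) ^ e) has_real_derivative
      (DF (Suc i) s * (x - s) ^ e - DF i s * (- real e * (x - s) ^ d))
        / ((x - s) ^ e * (x - s) ^ e)) (at s)"
    by (rule DERIV_divide[OF higher_deriv_F_has_derivative[OF assms(1)] den]) (use nz in auto)
  moreover have "(DF (Suc i) s * (x - s) ^ e - DF i s * (- real e * (x - s) ^ d))
        / ((x - s) ^ e * (x - s) ^ e)
      = DF (Suc i) s / (x - s) ^ e + real e * DF i s / (x - s) ^ Suc e"
  proof -
    have "(A * z ^ Suc d - B * (- c * z ^ d)) / (z ^ Suc d * z ^ Suc d)
        = A / z ^ Suc d + c * B / z ^ Suc (Suc d)" if "z \<noteq> 0" for A B c z :: real
      using that by (simp add: field_simps)
    then show ?thesis using nz unfolding Suc by blast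
  qed
  ultimately show ?thesis by simp
qed

lemma power_F_expansion:
  assumes "Q t > 0" "t \<noteq> x"
  shows "of_int (dfact (2 * int N - 1)) * F t x ^ (2 * N + 1) =
    (\<Sum>i\<le>N. of_int (ode_coeff N i) * (DF i t / (x - t) ^ (2 * N - i)))"
  using assms
proof (induction N arbitrary: t)
  case 0
  then show ?case by (simp add: dfact.simps)
next
  case (Suc N)
  let ?b = "\<lambda>N i. real_of_int (ode_coeff N i)"
  define d where "d = real_of_int (dfact (2 * int N - 1))"
  define y where "y = x - t"
  have y: "y \<noteq> 0" using Suc.prems by (simp add: y_def)
  define R where "R = (\<Sum>i\<le>N. ?b N i * (DF (Suc i) t / y ^ (2 * N - i)
      + real (2 * N - i) * DF i t / y ^ Suc (2 * N - i)))"
  have lhs: "((\<lambda>s. d * F s x ^ (2 * N + 1)) has_real_derivative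
      d * (real (2 * N + 1) * y * F t x ^ (2 * N + 3))) (at t)"
    unfolding y_def by (rule DERIV_cmult[OF F_power_has_derivative]) (use Suc.prems in auto)
  have rhs: "((\<lambda>s. \<Sum>i\<le>N. ?b N i * (DF i s / (x - s) ^ (2 * N - i))) has_real_derivative R) (at t)"
    unfolding R_def y_def
    by (rule DERIV_sum, rule DERIV_cmult, rule higher_deriv_F_quotient_has_derivative)
       (use Suc.prems in auto)
  \<comment> \<open>The induction hypothesis holds on a neighbourhood of \<open>t\<close>, so both sides have the same derivative.\<close>
  have op: "open ({s. Q s > 0} - {x})"
    by (intro open_Diff open_Q_pos) auto
  have "((\<lambda>s. d * F s x ^ (2 * N + 1)) has_real_derivative R) (at t)"
    by (rule has_field_derivative_transform_within_open[OF rhs op])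
       (use Suc in \<open>auto simp: d_def\<close>)
  then have R: "d * (real (2 * N + 1) * y * F t x ^ (2 * N + 3)) = R"
    using lhs DERIV_unique by blast
  have "dfact (2 * int (Suc N) - 1) = (2 * int N + 1) * dfact (2 * int N - 1)"
    using dfact_step[of "2 * int N - 1"] by (simp add: algebra_simps)
  then have "of_int (dfact (2 * int (Suc N) - 1)) * F t x ^ (2 * Suc N + 1)
      = d * (real (2 * N + 1) * y * F t x ^ (2 * N + 3)) / y"
    using y by (simp add: d_def numeral_3_eq_3)
  also have "\<dots> = R / y" by (simp only: R)
  also have "\<dots> = (\<Sum>i\<le>N. ?b N i * (DF (Suc i) t / y ^ (2 * Suc N - Suc i)))
      + (\<Sum>i\<le>N. (2 * real N - real i) * ?b N i * (DF i t / y ^ (2 * Suc N - i)))"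
    unfolding R_def sum_divide_distrib sum.distrib[symmetric]
  proof (rule sum.cong[OF refl])
    fix i assume "i \<in> {..N}"
    then have e: "2 * Suc N - Suc i = Suc (2 * N - i)" "2 * Suc N - i = Suc (Suc (2 * N - i))"
      "real (2 * N - i) = 2 * real N - real i"
      by auto
    show "?b N i * (DF (Suc i) t / y ^ (2 * N - i)
        + real (2 * N - i) * DF i t / y ^ Suc (2 * N - i)) / y
      = ?b N i * (DF (Suc i) t / y ^ (2 * Suc N - Suc i))
        + (2 * real N - real i) * ?b N i * (DF i t / y ^ (2 * Suc N - i))"
      unfolding e using y by (simp add: field_simps)
  qed
  \<comment> \<open>Both sums are rewritten over the same index range, which allows comparison with the recurrence:
    the first by a shift, the second by adding a zero term.\<close>
  also have "(\<Sum>i\<le>N. ?b N i * (DF (Suc i) t / y ^ (2 * Suc N - Suc i)))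
      = (\<Sum>i\<le>Suc N. (case i of 0 \<Rightarrow> 0 | Suc j \<Rightarrow> ?b N j) * (DF i t / y ^ (2 * Suc N - i)))"
    by (subst sum.atMost_Suc_shift) simp
  also have "(\<Sum>i\<le>N. (2 * real N - real i) * ?b N i * (DF i t / y ^ (2 * Suc N - i)))
      = (\<Sum>i\<le>Suc N. (2 * real N - real i) * ?b N i * (DF i t / y ^ (2 * Suc N - i)))"
    by (simp add: ode_coeff_eq_0)
  also have "(\<Sum>i\<le>Suc N. (case i of 0 \<Rightarrow> 0 | Suc j \<Rightarrow> ?b N j) * (DF i t / y ^ (2 * Suc N - i)))
      + (\<Sum>i\<le>Suc N. (2 * real N - real i) * ?b N i * (DF i t / y ^ (2 * Suc N - i)))
      = (\<Sum>i\<le>Suc N. ?b (Suc N) i * (DF i t / y ^ (2 * Suc N - i)))"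
    unfolding sum.distrib[symmetric] distrib_right[symmetric]
  proof (rule sum.cong[OF refl])
    fix i
    have "?b (Suc N) i = (case i of 0 \<Rightarrow> 0 | Suc j \<Rightarrow> ?b N j) + (2 * real N - real i) * ?b N i"
      by (cases i) simp_all
    then show "((case i of 0 \<Rightarrow> 0 | Suc j \<Rightarrow> ?b N j) + (2 * real N - real i) * ?b N i)
        * (DF i t / y ^ (2 * Suc N - i)) = ?b (Suc N) i * (DF i t / y ^ (2 * Suc N - i))"
      by (simp only:)
  qed
  finally show ?case by (simp only: y_def)
qed

end

section \<open>Solving the recurrence\<close>

lemma fall2_0 [simp]: "fall2 M 0 = 1"
  by (simp add: fall2_def)

lemma fall2_Suc: "fall2 M (Suc k) = M * fall2 (M - 2) k"
  unfolding fall2_def by (subst prod.lessThan_Suc_shift) (simp add: algebra_simps)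

text \<open>The \<open>l\<close>-th summand collects the ways to make \<open>l\<close> steps of the recurrence at index \<open>j + 1\<close>
  before the index drops to \<open>j\<close>; if it never drops, the recursion reaches the diagonal after \<open>p\<close>
  steps. In terms of the row \<open>r = j + 1 + p\<close> and the index \<open>i = j + 1\<close>, the number \<open>j + 2p - 1\<close> is
  \<open>2(r - 1) - i\<close>, the factor of the first step; each further step lowers it by \<open>2\<close>. Writing the row
  as distance \<open>p\<close> from the diagonal keeps all subtractions of naturals exact.\<close>

lemma ode_coeff_unroll:
  "ode_coeff (Suc j + p) (Suc j) =
     fall2 (int j + 2 * int p - 1) p
     + (\<Sum>l<p. fall2 (int j + 2 * int p - 1) l * ode_coeff (j + p - l) j)"
proof (induction p)
  case 0
  show ?case using ode_coeff_diag[of "Suc j"] by (simp del: ode_coeff_diag)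
next
  case (Suc p)
  let ?M = "int j + 2 * int p - 1"
  have M: "int j + 2 * int (Suc p) - 1 = ?M + 2" by simp
  have "ode_coeff (Suc j + Suc p) (Suc j)
      = (?M + 2) * ode_coeff (Suc j + p) (Suc j) + ode_coeff (j + Suc p) j"
    using ode_coeff.simps(2)[of "Suc j + p" "Suc j"] by (simp add: algebra_simps)
  also have "\<dots> = fall2 (?M + 2) (Suc p)
      + (ode_coeff (j + Suc p) j + (\<Sum>l<p. fall2 (?M + 2) (Suc l) * ode_coeff (j + p - l) j))"
    unfolding Suc by (simp add: fall2_Suc sum_distrib_left algebra_simps)
  also have "\<dots> = fall2 (?M + 2) (Suc p)
      + (\<Sum>l<Suc p. fall2 (?M + 2) l * ode_coeff (j + Suc p - l) j)"
    by (subst sum.lessThan_Suc_shift) simp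
  finally show ?case unfolding M .
qed

lemma nested_sum_Suc_inner:
  "nested_sum N i (Suc n) g ls =
     nested_sum N i n (\<lambda>ls. \<Sum>l<N - sum_list ls - i. g (ls @ [l])) ls"
proof (induction n arbitrary: ls)
  case (Suc n)
  show ?case
    by (subst (1 2) nested_sum.simps(2)) (simp only: Suc)
qed simp

lemma nested_sum_add:
  "nested_sum N i n (\<lambda>ls. g ls + h ls) ls = nested_sum N i n g ls + nested_sum N i n h ls"
  by (induction n arbitrary: ls) (simp_all add: sum.distrib)

text \<open>Only index lists whose total leaves \<open>N - sum_list ls > i\<close> are visited, so that subtraction of
  natural numbers is exact wherever the summand is evaluated.\<close>

lemma nested_sum_cong:
  assumes "sum_list ls + i < N"
    and "\<And>ls'. length ls' = length ls + n \<Longrightarrow> sum_list ls' + i < N \<Longrightarrow> g ls' = h ls'"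
  shows "nested_sum N i n g ls = nested_sum N i n h ls"
  using assms
proof (induction n arbitrary: ls)
  case (Suc n)
  show ?case
    unfolding nested_sum.simps
    by (intro sum.cong refl Suc.IH) (use Suc.prems in auto)
qed simp

lemma psum_length: "length ls = n \<Longrightarrow> psum ls n = int (sum_list ls)"
  by (simp add: psum_def)

lemma fall_prod_append:
  assumes "length ls = n"
  shows "fall_prod N i (Suc n) (ls @ [l]) =
    fall_prod N i n ls * fall2 (2 * int N - 2 * int (sum_list ls) - int i - int n - 2) l"
  using assms by (auto simp: fall_prod_def psum_def nth_append algebra_simps intro!: prod.cong)

text \<open>Each of the \<open>n\<close> unrollings lowers the index by one and the row by one more than the new
  summation index. So after the choices \<open>ls\<close> the current entry is in row \<open>N - sum_list ls - n\<close> and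
  column \<open>i - n\<close>, still at distance \<open>N - sum_list ls - i\<close> from the diagonal, which explains the
  common form of all summation bounds.\<close>

lemma ode_coeff_nested_expansion:
  assumes "i < N" "n < i"
  shows "ode_coeff N i =
    (\<Sum>k=1..n. nested_sum N i (k - 1)
       (\<lambda>ls. fall_prod N i (k - 1) ls *
             (\<Prod>m<N - sum_list ls - i.
                2 * int N - 2 * psum ls (k - 1) - 2 * int m - int i - int k - 1)) [])
    + nested_sum N i n (\<lambda>ls. fall_prod N i n ls * ode_coeff (N - sum_list ls - n) (i - n)) []"
  using assms(2)
proof (induction n)
  case 0
  show ?case by (simp add: fall_prod_def)
next
  case (Suc n)
  let ?P = "\<lambda>ls. fall_prod N i n ls * (\<Prod>m<N - sum_list ls - i.
      2 * int N - 2 * psum ls n - 2 * int m - int i - int (Suc n) - 1)"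
  let ?R = "\<lambda>ls. fall_prod N i (Suc n) ls * ode_coeff (N - sum_list ls - Suc n) (i - Suc n)"
  have "nested_sum N i n (\<lambda>ls. fall_prod N i n ls * ode_coeff (N - sum_list ls - n) (i - n)) []
      = nested_sum N i n (\<lambda>ls. ?P ls + (\<Sum>l<N - sum_list ls - i. ?R (ls @ [l]))) []"
  proof (rule nested_sum_cong)
    fix ls :: "nat list"
    assume "length ls = length ([] :: nat list) + n" and s: "sum_list ls + i < N"
    then have len: "length ls = n" by simp
    define j p where "j = i - Suc n" and "p = N - sum_list ls - i"
    have eqs: "N - sum_list ls - n = Suc j + p" "i - n = Suc j"
      "\<And>l. N - sum_list (ls @ [l]) - Suc n = j + p - l"
      using s Suc.prems by (auto simp: j_def p_def)
    have M: "2 * int N - 2 * int (sum_list ls) - int i - int n - 2 = int j + 2 * int p - 1"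
      using s Suc.prems by (simp add: j_def p_def of_nat_diff)
    have P: "(\<Prod>m<p. 2 * int N - 2 * psum ls n - 2 * int m - int i - int (Suc n) - 1)
        = fall2 (int j + 2 * int p - 1) p"
      unfolding fall2_def M[symmetric] psum_length[OF len]
      by (intro prod.cong) auto
    show "fall_prod N i n ls * ode_coeff (N - sum_list ls - n) (i - n)
        = ?P ls + (\<Sum>l<N - sum_list ls - i. ?R (ls @ [l]))"
      unfolding eqs p_def[symmetric] j_def[symmetric] P fall_prod_append[OF len] M ode_coeff_unroll
      by (simp add: algebra_simps sum_distrib_left)
  qed (use assms in simp)
  also have "\<dots> = nested_sum N i n ?P [] + nested_sum N i (Suc n) ?R []"
    by (simp only: nested_sum_add nested_sum_Suc_inner)
  finally show ?case
    using Suc by simp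
qed

lemma a_coeff_eq_ode_coeff:
  assumes "1 \<le> i" "i \<le> N"
  shows "a_coeff N i = ode_coeff N i"
proof -
  consider "i = 1" | "i \<noteq> 1" "i = N" | "i \<noteq> 1" "i < N" using assms by linarith
  then show ?thesis
  proof cases
    case 1
    then show ?thesis
      using ode_coeff_1[of "N - 1"] assms by (simp add: a_coeff_def of_nat_diff algebra_simps)
  next
    case 2
    then show ?thesis by (simp add: a_coeff_def)
  next
    case 3
    have "nested_sum N i (i - 1)
        (\<lambda>ls. fall_prod N i (i - 1) ls * ode_coeff (N - sum_list ls - (i - 1)) (i - (i - 1))) []
      = nested_sum N i (i - 1)
        (\<lambda>ls. fall_prod N i (i - 1) ls * dfact (2 * (int N - psum ls (i - 1) - int i) - 1)) []"
    proof (rule nested_sum_cong)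
      fix ls :: "nat list"
      assume "length ls = length ([] :: nat list) + (i - 1)" and s: "sum_list ls + i < N"
      then have len: "length ls = i - 1" by simp
      define q where "q = N - sum_list ls - i"
      have row: "N - sum_list ls - (i - 1) = Suc q" "i - (i - 1) = 1"
        using s assms by (auto simp: q_def)
      have "int q = int N - int (sum_list ls) - int i"
        using s by (simp add: q_def of_nat_diff)
      then show "fall_prod N i (i - 1) ls * ode_coeff (N - sum_list ls - (i - 1)) (i - (i - 1))
          = fall_prod N i (i - 1) ls * dfact (2 * (int N - psum ls (i - 1) - int i) - 1)"
        unfolding row psum_length[OF len] ode_coeff_1 by simp
    qed (use 3 in simp)
    then show ?thesis
      using ode_coeff_nested_expansion[of i N "i - 1"] 3 assms
      by (simp add: a_coeff_def)
  qed
qed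

section \<open>The differential equation\<close>

theorem theorem1:
  fixes N :: nat and t x :: real
  assumes "N \<ge> 1"
    and "1 - 2 * t * x + t\<^sup>2 > 0"
    and "t \<noteq> x"
  shows "of_int (dfact (2 * int N - 1)) * F t x ^ (2 * N + 1) =
    (\<Sum>i=1..N. of_int (a_coeff N i) * ((deriv ^^ i) (\<lambda>s. F s x) t / (x - t) ^ (2 * N - i)))"
proof -
  have "of_int (dfact (2 * int N - 1)) * F t x ^ (2 * N + 1)
      = (\<Sum>i\<le>N. of_int (ode_coeff N i) * ((deriv ^^ i) (\<lambda>s. F s x) t / (x - t) ^ (2 * N - i)))"
    by (rule power_F_expansion) (use assms in auto)
  also have "\<dots> = (\<Sum>i=1..N. of_int (ode_coeff N i) *
      ((deriv ^^ i) (\<lambda>s. F s x) t / (x - t) ^ (2 * N - i)))"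
    by (rule sum.mono_neutral_right) (use assms in \<open>auto simp: not_le Suc_le_eq\<close>)
  also have "\<dots> = (\<Sum>i=1..N. of_int (a_coeff N i) *
      ((deriv ^^ i) (\<lambda>s. F s x) t / (x - t) ^ (2 * N - i)))"
    by (intro sum.cong) (auto simp: a_coeff_eq_ode_coeff)
  finally show ?thesis .
qed

end
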